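(* For any integer $n \geq 3$ and any $d$-degenerate graph $G$, $\mathrm{ch}_\Sigma^e(G \,\Box\, K_n) \leq nd + 3$.
   Context: All graphs are finite, simple and loopless. A graph is $d$-degenerate if every induced subgraph of it has a vertex of degree (in that subgraph) at most $d$. The Cartesian product $G\,\Box\,H$ has vertex set $V(G)\times V(H)$, with $(u,u')$ and $(v,v')$ adjacent if and only if either $u=v$ and $u'v'\in E(H)$, or $u'=v'$ and $uv\in E(G)$. $\mathrm{ch}_\Sigma^e(G)$ is the smallest positive integer $k$ such that for every assignment of a list $L_e$ of $k$ real numbers to each edge $e$ of $G$ there is a choice of weights $w(e)\in L_e$ ($e \in E(G)$) for which $v \mapsto \sum_{e\ni v} w(e)$ is a proper colouring of $V(G)$ (adjacent vertices get different sums). *)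

theory Defs
  imports Complex_Main "HOL-Library.Extended_Nat" "HOL-Library.Ramsey"
begin

datatype 'a ugraph = UGraph (verts: "'a set") (edges: "'a set set")

(* Edges are 2-element subsets of the vertex set, so loops and multiple edges cannot occur. *)
definition simple_graph :: "'a ugraph \<Rightarrow> bool" where
  "simple_graph G \<longleftrightarrow> finite (verts G) \<and> edges G \<subseteq> [verts G]\<^bsup>2\<^esup>"

definition incident_edges :: "'a ugraph \<Rightarrow> 'a \<Rightarrow> 'a set set" where
  "incident_edges G v = {e \<in> edges G. v \<in> e}"

definition vert_degree :: "'a ugraph \<Rightarrow> 'a \<Rightarrow> nat" where
  "vert_degree G v = card (incident_edges G v)"

definition induced_ugraph :: "'a ugraph \<Rightarrow> 'a set \<Rightarrow> 'a ugraph" where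
  "induced_ugraph G U = UGraph U {e \<in> edges G. e \<subseteq> U}"

(* The induced subgraph without vertices is excluded: it has no vertex of any degree. *)
definition degenerate :: "nat \<Rightarrow> 'a ugraph \<Rightarrow> bool" where
  "degenerate d G \<longleftrightarrow>
     (\<forall>U. U \<subseteq> verts G \<and> U \<noteq> {} \<longrightarrow> (\<exists>v\<in>U. vert_degree (induced_ugraph G U) v \<le> d))"

definition box_product :: "'a ugraph \<Rightarrow> 'b ugraph \<Rightarrow> ('a \<times> 'b) ugraph" where
  "box_product G H = UGraph (verts G \<times> verts H)
     {{(u, u'), (v, v')} | u u' v v'.
        u \<in> verts G \<and> v \<in> verts G \<and> u' \<in> verts H \<and> v' \<in> verts H \<and>
        (u = v \<and> {u', v'} \<in> edges H \<or> u' = v' \<and> {u, v} \<in> edges G)}"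

definition complete_graph :: "nat \<Rightarrow> nat ugraph" where
  "complete_graph n = UGraph {..<n} ([{..<n}]\<^bsup>2\<^esup>)"

definition proper_colouring :: "'a ugraph \<Rightarrow> ('a \<Rightarrow> 'c) \<Rightarrow> bool" where
  "proper_colouring G c \<longleftrightarrow>
     (\<forall>u\<in>verts G. \<forall>v\<in>verts G. {u, v} \<in> edges G \<longrightarrow> c u \<noteq> c v)"

(* As usual for list colourings, a list of k numbers is a set of k distinct numbers. *)
definition sum_edge_choosable :: "nat \<Rightarrow> 'a ugraph \<Rightarrow> bool" where
  "sum_edge_choosable k G \<longleftrightarrow>
     (\<forall>L :: 'a set \<Rightarrow> real set.
        (\<forall>e\<in>edges G. finite (L e) \<and> card (L e) = k) \<longrightarrow>
        (\<exists>w :: 'a set \<Rightarrow> real. (\<forall>e\<in>edges G. w e \<in> L e) \<and>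
           proper_colouring G (\<lambda>v. \<Sum>e\<in>incident_edges G v. w e)))"

(* The value is \<infinity> if no k works, for example if some component is a single edge. *)
definition ch_sum_edge :: "'a ugraph \<Rightarrow> enat" where
  "ch_sum_edge G = Inf {enat k | k. 0 < k \<and> sum_edge_choosable k G}"

end

theory Submission
  imports Defs
begin

text \<open>
  Vertices are allowed to start with arbitrary real offsets, so that weights that are already fixed
  can be absorbed into them. If \<open>v\<close> has at most \<open>d\<close> neighbours in \<open>G\<close>, fix the weights of the edges
  that leave its fibre arbitrarily, weight \<open>(G - v) \<box> K\<^sub>n\<close> by induction, and then weight the
  fibre \<open>K\<^sub>n\<close> so that the sums are distinct and each avoids at most \<open>d\<close> values.

  For a clique whose vertices have \<open>r\<close> forbidden values in total, lists of size \<open>r + 3\<close> suffice. Take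
  the vertex with the largest attainable sum. If that sum is forbidden there, drop the top of every
  list, which disposes of one forbidden value at the cost of one element per list. Otherwise let the
  vertex attain it. The next vertex takes the smallest attainable sum, and so on alternately, which
  makes the comparisons strict. The final triangle is weighted greedily.
\<close>

section \<open>Weighting a clique with forbidden sums\<close>

lemma exists_avoiding:
  assumes "finite (C :: 'b set)" "card C < card (A :: 'b set)"
  shows "\<exists>a\<in>A. a \<notin> C"
  using assms by (metis card_mono leD subsetI)

text \<open>The weights are chosen greedily in the order \<open>{x, y}\<close>,
  \<open>{x, z}\<close>, \<open>{y, z}\<close>, and the choices exclude at most 1,
  \<open>2 + card (B x)\<close> and \<open>2 + card (B y) + card (B z)\<close> values. When two sums
  are compared, the weight of their common edge cancels, hence the form of the last three
  conclusions.\<close>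

lemma triangle_weighting:
  fixes f :: "'v \<Rightarrow> real" and L :: "'v set \<Rightarrow> real set"
  assumes dist: "x \<noteq> y" "x \<noteq> z" "y \<noteq> z"
    and fin: "finite (B x)" "finite (B y)" "finite (B z)"
    and lists: "\<And>e. e \<in> {{x, y}, {x, z}, {y, z}} \<Longrightarrow> 3 + card (B x) + card (B y) + card (B z) \<le> card (L e)"
  obtains w where "w {x, y} \<in> L {x, y}" "w {x, z} \<in> L {x, z}" "w {y, z} \<in> L {y, z}"
    "w {x, y} \<noteq> Min (L {x, y})" "w {x, z} \<noteq> Min (L {x, z})"
    "f x + w {x, y} + w {x, z} \<notin> B x" "f y + w {x, y} + w {y, z} \<notin> B y"
    "f z + w {x, z} + w {y, z} \<notin> B z"
    "f x + w {x, y} \<noteq> f z + w {y, z}" "f x + w {x, z} \<noteq> f y + w {y, z}"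
    "f y + w {x, y} \<noteq> f z + w {x, z}"
proof -
  have "card {Min (L {x, y})} < card (L {x, y})"
    using lists[of "{x, y}"] by simp
  then obtain c where c: "c \<in> L {x, y}" "c \<noteq> Min (L {x, y})"
    using exists_avoiding[of "{Min (L {x, y})}"] by auto
  \<comment> \<open>\<open>f y + c - f z\<close> is the weight that would equate the sums at
    \<open>y\<close> and \<open>z\<close>, whatever \<open>{y, z}\<close> receives later. The image
    consists of the weights that bring the sum at \<open>x\<close>, completed by this choice, into
    \<open>B x\<close>.\<close>
  define C where "C = {Min (L {x, z}), f y + c - f z} \<union> (\<lambda>t. t - f x - c) ` B x"
  have "card C \<le> 2 + card (B x)"
    unfolding C_def
    by (intro order_trans[OF card_Un_le] add_mono card_image_le fin) (simp add: card_insert_if)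
  then have "card C < card (L {x, z})"
    using lists[of "{x, z}"] by simp
  moreover have "finite C"
    using fin by (simp add: C_def)
  ultimately obtain b where b: "b \<in> L {x, z}" "b \<notin> C"
    using exists_avoiding by blast
  \<comment> \<open>This edge completes both \<open>y\<close> and \<open>z\<close>. The two listed
    values would equate the sum at \<open>x\<close> with that at \<open>z\<close> or at
    \<open>y\<close>; the images guard \<open>B y\<close> and \<open>B z\<close>.\<close>
  define D where "D = {f x + c - f z, f x + b - f y} \<union>
    ((\<lambda>t. t - f y - c) ` B y \<union> (\<lambda>t. t - f z - b) ` B z)"
  have "card D \<le> 2 + (card (B y) + card (B z))"
    unfolding D_def
    by (intro order_trans[OF card_Un_le] add_mono card_image_le fin) (simp add: card_insert_if)
  then have "card D < card (L {y, z})"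
    using lists[of "{y, z}"] by simp
  moreover have "finite D"
    using fin by (simp add: D_def)
  ultimately obtain a where a: "a \<in> L {y, z}" "a \<notin> D"
    using exists_avoiding by blast
  define w where "w = (\<lambda>e. if e = {x, y} then c else if e = {x, z} then b else a)"
  have w: "w {x, y} = c" "w {x, z} = b" "w {y, z} = a"
    using dist by (auto simp: w_def doubleton_eq_iff)
  have "f x + c + b \<notin> B x"
  proof
    assume "f x + c + b \<in> B x"
    then have "b \<in> (\<lambda>t. t - f x - c) ` B x" by (intro image_eqI) auto
    then show False using b by (simp add: C_def)
  qed
  moreover have "f y + c + a \<notin> B y"
  proof
    assume "f y + c + a \<in> B y"
    then have "a \<in> (\<lambda>t. t - f y - c) ` B y" by (intro image_eqI) auto
    then show False using a by (simp add: D_def)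
  qed
  moreover have "f z + b + a \<notin> B z"
  proof
    assume "f z + b + a \<in> B z"
    then have "a \<in> (\<lambda>t. t - f z - b) ` B z" by (intro image_eqI) auto
    then show False using a by (simp add: D_def)
  qed
  moreover have "f x + c \<noteq> f z + a" "f x + b \<noteq> f y + a" "f y + c \<noteq> f z + b" "b \<noteq> Min (L {x, z})"
    using a b by (auto simp: C_def D_def)
  ultimately show thesis
    using that[of w] a(1) b(1) c unfolding w by blast
qed

text \<open>The last conclusion carries the induction: for the negated instance that remains after a
  vertex is removed, it says that all sums stay strictly below their maxima.\<close>

lemma clique_weighting:
  fixes f :: "'v \<Rightarrow> real" and L :: "'v set \<Rightarrow> real set"
  assumes "finite W" "3 \<le> card W"
    and "\<And>x. x \<in> W \<Longrightarrow> finite (B x)"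
    and "\<And>x y. x \<in> W \<Longrightarrow> y \<in> W \<Longrightarrow> x \<noteq> y \<Longrightarrow>
      finite (L {x, y}) \<and> 3 + (\<Sum>x\<in>W. card (B x)) \<le> card (L {x, y})"
  shows "\<exists>w. (\<forall>x\<in>W. \<forall>y\<in>W. x \<noteq> y \<longrightarrow> w {x, y} \<in> L {x, y}) \<and>
    inj_on (\<lambda>x. f x + (\<Sum>y\<in>W - {x}. w {x, y})) W \<and>
    (\<forall>x\<in>W. f x + (\<Sum>y\<in>W - {x}. w {x, y}) \<notin> B x) \<and>
    (\<forall>x\<in>W. (\<Sum>y\<in>W - {x}. Min (L {x, y})) < (\<Sum>y\<in>W - {x}. w {x, y}))"
  using assms
\<comment> \<open>The measure counts forbidden values as well as vertices, because one case keeps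
  \<open>W\<close> and only removes a forbidden value.\<close>
proof (induction "card W + (\<Sum>x\<in>W. card (B x))" arbitrary: W f B L rule: less_induct)
  case less
  note finW = less.prems(1) and finB = less.prems(3)
  have finL: "finite (L {x, y})" and cardL: "3 + (\<Sum>x\<in>W. card (B x)) \<le> card (L {x, y})"
    if "x \<in> W" "y \<in> W" "x \<noteq> y" for x y
    using less.prems(4)[OF that] by auto
  have neL: "L {x, y} \<noteq> {}" if "x \<in> W" "y \<in> W" "x \<noteq> y" for x y
    using cardL[OF that] by auto
  have Min_less_Max: "Min (L {x, y}) < Max (L {x, y})" if "x \<in> W" "y \<in> W" "x \<noteq> y" for x y
  proof -
    have "card {Min (L {x, y})} < card (L {x, y})" using cardL[OF that] by simp
    then obtain t where "t \<in> L {x, y}" "t \<noteq> Min (L {x, y})"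
      using exists_avoiding[of "{Min (L {x, y})}"] by auto
    then show ?thesis
      using finL[OF that] by (metis Max_ge Min_le order_less_le order_less_le_trans)
  qed
  \<comment> \<open>\<open>U x\<close> is the sum at \<open>x\<close> when every edge at
    \<open>x\<close> takes its largest weight; \<open>v\<close> is a vertex that maximises
    it.\<close>
  define U where "U x = f x + (\<Sum>y\<in>W - {x}. Max (L {x, y}))" for x
  have "Max (U ` W) \<in> U ` W"
    using finW less.prems(2) by (intro Max_in) auto
  then obtain v where v: "v \<in> W" and vMax: "U v = Max (U ` W)"
    by (metis imageE)
  have v_ge: "U x \<le> U v" if "x \<in> W" for x
    using that finW by (simp add: vMax)
  consider "card W = 3" | "card W > 3" "U v \<in> B v" | "card W > 3" "U v \<notin> B v"
    using less.prems(2) by linarith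
  then show ?case
  proof cases
    case 1
    then obtain x y z where W: "W = {x, y, z}" and dist: "x \<noteq> y" "x \<noteq> z" "y \<noteq> z"
      by (metis card_3_iff)
    have sumB: "(\<Sum>x\<in>W. card (B x)) = card (B x) + card (B y) + card (B z)"
      using dist by (simp add: W)
    have fin3: "finite (B x)" "finite (B y)" "finite (B z)"
      using finB by (auto simp: W)
    have lists: "3 + card (B x) + card (B y) + card (B z) \<le> card (L e)"
      if "e \<in> {{x, y}, {x, z}, {y, z}}" for e
      using that cardL[of x y] cardL[of x z] cardL[of y z] dist unfolding sumB by (auto simp: W)
    obtain w where w: "w {x, y} \<in> L {x, y}" "w {x, z} \<in> L {x, z}" "w {y, z} \<in> L {y, z}"
      "w {x, y} \<noteq> Min (L {x, y})" "w {x, z} \<noteq> Min (L {x, z})"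
      "f x + w {x, y} + w {x, z} \<notin> B x" "f y + w {x, y} + w {y, z} \<notin> B y"
      "f z + w {x, z} + w {y, z} \<notin> B z"
      "f x + w {x, y} \<noteq> f z + w {y, z}" "f x + w {x, z} \<noteq> f y + w {y, z}"
      "f y + w {x, y} \<noteq> f z + w {x, z}"
      by (rule triangle_weighting[where f = f and L = L, OF dist fin3 lists]) (assumption, rule that)
    \<comment> \<open>Each of the three vertices lies on \<open>{x, y}\<close> or
      \<open>{x, z}\<close>, so strictness on these two edges suffices for all three sums.\<close>
    have Min: "Min (L {x, y}) < w {x, y}" "Min (L {x, z}) < w {x, z}" "Min (L {y, z}) \<le> w {y, z}"
      using w(1-5) finL dist by (auto simp: W order_less_le Min_le)
    have D: "W - {x} = {y, z}" "W - {y} = {x, z}" "W - {z} = {x, y}"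
      using dist by (auto simp: W)
    have sums: "(\<Sum>u\<in>W - {x}. g {x, u}) = g {x, y} + g {x, z}"
      "(\<Sum>u\<in>W - {y}. g {y, u}) = g {x, y} + g {y, z}"
      "(\<Sum>u\<in>W - {z}. g {z, u}) = g {x, z} + g {y, z}" for g :: "'v set \<Rightarrow> real"
      using dist unfolding D by (auto simp: insert_commute)
    have "inj_on (\<lambda>x. f x + (\<Sum>y\<in>W - {x}. w {x, y})) {x, y, z}"
      using w(9-11) dist by (auto simp: sums)
    moreover have "\<forall>x\<in>{x, y, z}. f x + (\<Sum>y\<in>W - {x}. w {x, y}) \<notin> B x"
      using w(6-8) by (simp add: sums add.assoc)
    moreover have "\<forall>x\<in>{x, y, z}. (\<Sum>y\<in>W - {x}. Min (L {x, y})) < (\<Sum>y\<in>W - {x}. w {x, y})"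
      using Min sums[of "\<lambda>e. Min (L e)"] by (simp add: sums)
    moreover have "\<forall>x\<in>W. \<forall>y\<in>W. x \<noteq> y \<longrightarrow> w {x, y} \<in> L {x, y}"
      using w(1-3) by (auto simp: W insert_commute)
    ultimately show ?thesis
      unfolding W[symmetric] by (intro exI[of _ w] conjI)
  next
    case 2
    text \<open>Dropping the largest element of every list makes the value \<open>U v\<close> unattainable at \<open>v\<close>, so
      it need not be forbidden any longer.\<close>
    define B' where "B' = B(v := B v - {U v})"
    define L' where "L' e = L e - {Max (L e)}" for e
    have "card (B' v) + 1 = card (B v)"
      using 2 finB[OF v] card_Suc_Diff1[of "B v" "U v"] by (simp add: B'_def)
    moreover have "(\<Sum>x\<in>W - {v}. card (B' x)) = (\<Sum>x\<in>W - {v}. card (B x))"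
      by (intro sum.cong) (auto simp: B'_def)
    ultimately have sumB': "(\<Sum>x\<in>W. card (B' x)) + 1 = (\<Sum>x\<in>W. card (B x))"
      using sum.remove[OF finW v, of "\<lambda>x. card (B x)"] sum.remove[OF finW v, of "\<lambda>x. card (B' x)"]
      by simp
    have L': "finite (L' {x, y}) \<and> 3 + (\<Sum>x\<in>W. card (B' x)) \<le> card (L' {x, y})"
      if "x \<in> W" "y \<in> W" "x \<noteq> y" for x y
      using finL[OF that] cardL[OF that] neL[OF that] sumB' by (simp add: L'_def)
    have "\<exists>w. (\<forall>x\<in>W. \<forall>y\<in>W. x \<noteq> y \<longrightarrow> w {x, y} \<in> L' {x, y}) \<and>
      inj_on (\<lambda>x. f x + (\<Sum>y\<in>W - {x}. w {x, y})) W \<and>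
      (\<forall>x\<in>W. f x + (\<Sum>y\<in>W - {x}. w {x, y}) \<notin> B' x) \<and>
      (\<forall>x\<in>W. (\<Sum>y\<in>W - {x}. Min (L' {x, y})) < (\<Sum>y\<in>W - {x}. w {x, y}))"
      using sumB' finB less.prems(2) by (intro less.hyps finW L') (auto simp: B'_def)
    then obtain w where w: "\<forall>x\<in>W. \<forall>y\<in>W. x \<noteq> y \<longrightarrow> w {x, y} \<in> L' {x, y}"
      and inj: "inj_on (\<lambda>x. f x + (\<Sum>y\<in>W - {x}. w {x, y})) W"
      and avoid: "\<forall>x\<in>W. f x + (\<Sum>y\<in>W - {x}. w {x, y}) \<notin> B' x"
      and low: "\<forall>x\<in>W. (\<Sum>y\<in>W - {x}. Min (L' {x, y})) < (\<Sum>y\<in>W - {x}. w {x, y})"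
      by (elim exE conjE) (rule that)
    have "w {v, y} < Max (L {v, y})" if "y \<in> W - {v}" for y
      using w that v finL[of v y] by (auto simp: L'_def order_less_le)
    moreover have "card (W - {v}) \<noteq> 0"
      using 2 v by simp
    then have "W - {v} \<noteq> {}"
      by (metis card.empty)
    ultimately have "f v + (\<Sum>y\<in>W - {v}. w {v, y}) < U v"
      unfolding U_def using finW by (intro add_strict_left_mono sum_strict_mono) auto
    with avoid have avoid': "\<forall>x\<in>W. f x + (\<Sum>y\<in>W - {x}. w {x, y}) \<notin> B x"
      by (auto simp: B'_def split: if_splits)
    \<comment> \<open>The strict lower bound transfers back to \<open>L\<close>, since minima can
      only rise when lists shrink. The weight in \<open>w\<close> shows that the smaller list is
      nonempty.\<close>
    have Min_L': "Min (L {x, y}) \<le> Min (L' {x, y})" if "x \<in> W" "y \<in> W" "x \<noteq> y" for x y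
      using w that finL[OF that] by (intro Min_antimono) (auto simp: L'_def)
    have "(\<Sum>y\<in>W - {x}. Min (L {x, y})) \<le> (\<Sum>y\<in>W - {x}. Min (L' {x, y}))" if "x \<in> W" for x
      using that Min_L' by (intro sum_mono) auto
    with low have low': "\<forall>x\<in>W. (\<Sum>y\<in>W - {x}. Min (L {x, y})) < (\<Sum>y\<in>W - {x}. w {x, y})"
      by (meson order_le_less_trans)
    show ?thesis
      using w inj avoid' low' by (intro exI[of _ w]) (auto simp: L'_def)
  next
    case 3
    text \<open>Give \<open>v\<close> the largest possible sum. The negated instance on the other vertices keeps their
      sums strictly below their maxima, hence below the sum of \<open>v\<close>.\<close>
    define W' where "W' = W - {v}"
    \<comment> \<open>The edge from \<open>x\<close> to \<open>v\<close> is fixed at its maximum and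
      absorbed into the offset before the sign is changed.\<close>
    define f' where "f' x = - (f x + Max (L {x, v}))" for x
    have W: "W = insert v W'" "v \<notin> W'" "finite W'"
      using v finW by (auto simp: W'_def)
    have cardW': "card W = Suc (card W')"
      using W by simp
    have sumB: "(\<Sum>x\<in>W. card (B x)) = card (B v) + (\<Sum>x\<in>W'. card (B x))"
      using W by simp
    have cardB': "card (uminus ` B x) = card (B x)" for x
      by (simp add: card_image)
    have "\<exists>w. (\<forall>x\<in>W'. \<forall>y\<in>W'. x \<noteq> y \<longrightarrow> w {x, y} \<in> uminus ` L {x, y}) \<and>
      inj_on (\<lambda>x. f' x + (\<Sum>y\<in>W' - {x}. w {x, y})) W' \<and>
      (\<forall>x\<in>W'. f' x + (\<Sum>y\<in>W' - {x}. w {x, y}) \<notin> uminus ` B x) \<and>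
      (\<forall>x\<in>W'. (\<Sum>y\<in>W' - {x}. Min (uminus ` L {x, y})) < (\<Sum>y\<in>W' - {x}. w {x, y}))"
    proof (intro less.hyps)
      show "card W' + (\<Sum>x\<in>W'. card (uminus ` B x)) < card W + (\<Sum>x\<in>W. card (B x))"
        unfolding cardB' cardW' sumB by simp
      show "finite W'" "3 \<le> card W'"
        using W 3 cardW' by auto
      show "finite (uminus ` B x)" if "x \<in> W'" for x
        using finB that W by auto
      fix x y
      assume "x \<in> W'" "y \<in> W'" "x \<noteq> y"
      then show "finite (uminus ` L {x, y}) \<and>
        3 + (\<Sum>x\<in>W'. card (uminus ` B x)) \<le> card (uminus ` L {x, y})"
        using finL[of x y] cardL[of x y] W sumB by (simp add: card_image)
    qed
    then obtain w' where w': "\<forall>x\<in>W'. \<forall>y\<in>W'. x \<noteq> y \<longrightarrow> w' {x, y} \<in> uminus ` L {x, y}"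
      and inj': "inj_on (\<lambda>x. f' x + (\<Sum>y\<in>W' - {x}. w' {x, y})) W'"
      and avoid': "\<forall>x\<in>W'. f' x + (\<Sum>y\<in>W' - {x}. w' {x, y}) \<notin> uminus ` B x"
      and low': "\<forall>x\<in>W'. (\<Sum>y\<in>W' - {x}. Min (uminus ` L {x, y})) < (\<Sum>y\<in>W' - {x}. w' {x, y})"
      by (elim exE conjE) (rule that)
    define w where "w e = (if v \<in> e then Max (L e) else - w' e)" for e
    define s where "s x = f x + (\<Sum>y\<in>W - {x}. w {x, y})" for x
    have split: "(\<Sum>y\<in>W - {x}. g {x, y}) = g {x, v} + (\<Sum>y\<in>W' - {x}. g {x, y})"
      if "x \<in> W'" for x and g :: "'v set \<Rightarrow> real"
    proof -
      have "W - {x} = insert v (W' - {x})"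
        using W that by auto
      then show ?thesis
        using W by simp
    qed
    have s_v: "s v = U v"
      by (simp add: s_def U_def w_def)
    have s_W': "s x = - (f' x + (\<Sum>y\<in>W' - {x}. w' {x, y}))" if "x \<in> W'" for x
    proof -
      have "(\<Sum>y\<in>W' - {x}. w {x, y}) = (\<Sum>y\<in>W' - {x}. - w' {x, y})"
        using that W by (intro sum.cong) (auto simp: w_def)
      then show ?thesis
        using that unfolding s_def split[OF that] by (simp add: w_def f'_def sum_negf)
    qed
    have s_less: "s x < s v" if "x \<in> W'" for x
    proof -
      \<comment> \<open>Negation turns maxima into minima, so \<open>low'\<close> amounts to
        \<open>s x < U x\<close>.\<close>
      have "(\<Sum>y\<in>W' - {x}. Min (uminus ` L {x, y})) = (\<Sum>y\<in>W' - {x}. - Max (L {x, y}))"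
      proof (intro sum.cong refl)
        fix y
        assume "y \<in> W' - {x}"
        then show "Min (uminus ` L {x, y}) = - Max (L {x, y})"
          using that W finL[of x y] neL[of x y] minus_Max_eq_Min[of "L {x, y}"] by auto
      qed
      then have "s x < U x"
        using bspec[OF low' that] s_W'[OF that] split[OF that, of "\<lambda>e. Max (L e)"]
        by (simp add: U_def f'_def sum_negf)
      also have "U x \<le> U v"
        using that W v_ge by simp
      finally show ?thesis
        by (simp add: s_v)
    qed
    have "inj_on s W'"
      using inj' by (simp add: inj_on_def s_W')
    with s_less have inj: "inj_on s W"
      using W by (force simp: inj_on_def)
    have avoid: "s x \<notin> B x" if "x \<in> W" for x
    proof (cases "x = v")
      case True
      then show ?thesis using 3 s_v by simp
    next
      case False
      then have "x \<in> W'" using that W by simp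
      then have "- s x \<notin> uminus ` B x"
        using avoid' by (simp only: s_W' minus_minus not_False_eq_True)
      then show ?thesis by blast
    qed
    have mem: "w {x, y} \<in> L {x, y}" if "x \<in> W" "y \<in> W" "x \<noteq> y" for x y
    proof (cases "v \<in> {x, y}")
      case True
      then show ?thesis using finL[OF that] neL[OF that] by (simp add: w_def)
    next
      case False
      then have "w' {x, y} \<in> uminus ` L {x, y}"
        using that W w' by auto
      then show ?thesis using False by (auto simp: w_def)
    qed
    have low: "(\<Sum>y\<in>W - {x}. Min (L {x, y})) < (\<Sum>y\<in>W - {x}. w {x, y})" if x: "x \<in> W" for x
    proof -
      have "W' \<noteq> {}"
        using 3 cardW' by auto
      then obtain u where u: "u \<in> W'" by blast
      \<comment> \<open>The edge \<open>{x, t}\<close> contains \<open>v\<close>, so it carries its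
        maximum. This exceeds its minimum because every list has at least three elements, and one
        strict edge at \<open>x\<close> is enough.\<close>
      define t where "t = (if x = v then u else v)"
      have t: "t \<in> W - {x}" "v \<in> {x, t}"
        using u W by (auto simp: t_def)
      show ?thesis
      proof (rule sum_strict_mono_ex1)
        show "finite (W - {x})" using finW by simp
        show "\<forall>y\<in>W - {x}. Min (L {x, y}) \<le> w {x, y}"
          using mem finL x by (auto intro!: Min_le)
        show "\<exists>y\<in>W - {x}. Min (L {x, y}) < w {x, y}"
          using t Min_less_Max[of x t] x by (intro bexI[of _ t]) (auto simp: w_def)
      qed
    qed
    show ?thesis
      using mem inj avoid low unfolding s_def by blast
  qed
qed

section \<open>Extending a weighting by a clique\<close>

text \<open>Quantifying over the offsets \<open>f\<close> lets weights fixed elsewhere be absorbed.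
  The lists \<open>L\<close> stay fixed, so the same assignment serves a graph and all its induced
  subgraphs.\<close>

definition list_weightable :: "('v set \<Rightarrow> real set) \<Rightarrow> 'v ugraph \<Rightarrow> bool" where
  "list_weightable L N \<longleftrightarrow> (\<forall>f. \<exists>w. (\<forall>e\<in>edges N. w e \<in> L e) \<and>
     proper_colouring N (\<lambda>v. f v + (\<Sum>e\<in>incident_edges N v. w e)))"

lemma edge_doubleton:
  assumes "simple_graph N" "e \<in> edges N"
  obtains x y where "e = {x, y}" "x \<noteq> y" "x \<in> verts N" "y \<in> verts N"
proof -
  have "e \<subseteq> verts N" "card e = 2"
    using assms by (auto simp: simple_graph_def nsets_def)
  then show thesis
    using that by (metis card_2_iff insert_subset)
qed

lemma finite_edges:
  assumes "simple_graph N"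
  shows "finite (edges N)"
proof (rule finite_subset)
  show "edges N \<subseteq> Pow (verts N)"
    using assms by (auto simp: simple_graph_def nsets_def)
  show "finite (Pow (verts N))"
    using assms by (simp add: simple_graph_def)
qed

lemma incident_edges_induced_ugraph:
  "incident_edges (induced_ugraph N X) x = {e \<in> edges N. e \<subseteq> X \<and> x \<in> e}"
  by (auto simp: incident_edges_def induced_ugraph_def)

text \<open>Edges between \<open>F\<close> and \<open>X\<close> are fixed first, then those inside
  \<open>X\<close>. The sums on \<open>X\<close> are then final, as edges inside \<open>F\<close> do
  not meet \<open>X\<close>. Each vertex of \<open>F\<close> thus has at most \<open>d\<close>
  forbidden sums, \<open>card F * d\<close> in total, and the clique can be weighted last.\<close>

lemma list_weightable_add_clique:
  fixes N :: "'v ugraph"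
  assumes N: "simple_graph N" and disj: "F \<inter> X = {}" and sub: "F \<union> X \<subseteq> verts N"
    and clique: "\<And>x y. x \<in> F \<Longrightarrow> y \<in> F \<Longrightarrow> x \<noteq> y \<Longrightarrow> {x, y} \<in> edges N"
    and cardF: "3 \<le> card F"
    and nbrs: "\<And>x. x \<in> F \<Longrightarrow> card {y \<in> X. {x, y} \<in> edges N} \<le> d"
    and L: "\<And>e. e \<in> edges N \<Longrightarrow> finite (L e) \<and> card F * d + 3 \<le> card (L e)"
    and X: "list_weightable L (induced_ugraph N X)"
  shows "list_weightable L (induced_ugraph N (F \<union> X))"
  unfolding list_weightable_def
proof
  fix f :: "'v \<Rightarrow> real"
  have finE: "finite (edges N)"
    using N by (rule finite_edges)
  have fin: "finite F" "finite X"
    using N sub by (auto simp: simple_graph_def intro: finite_subset)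
  define c where "c e = (SOME a. a \<in> L e)" for e
  have c: "c e \<in> L e" if "e \<in> edges N" for e
  proof -
    have "L e \<noteq> {}" using L[OF that] by auto
    then show ?thesis unfolding c_def by (meson all_not_in_conv someI)
  qed
  \<comment> \<open>These are the edges at \<open>x\<close> that join \<open>F\<close> to
    \<open>X\<close>.\<close>
  define R where "R x = {e \<in> edges N. e \<subseteq> F \<union> X \<and> \<not> e \<subseteq> F \<and> \<not> e \<subseteq> X \<and> x \<in> e}" for x
  define g where "g x = f x + (\<Sum>e\<in>R x. c e)" for x
  obtain w1 where w1: "\<And>e. e \<in> edges N \<Longrightarrow> e \<subseteq> X \<Longrightarrow> w1 e \<in> L e"
    and col1: "proper_colouring (induced_ugraph N X)
      (\<lambda>v. g v + (\<Sum>e\<in>incident_edges (induced_ugraph N X) v. w1 e))"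
    using X unfolding list_weightable_def
    by (fastforce simp: induced_ugraph_def)
  \<comment> \<open>On \<open>X\<close> this is already the final sum, since \<open>g\<close>
    includes the weights of the edges to \<open>F\<close>.\<close>
  define s1 where "s1 x = g x + (\<Sum>e\<in>{e \<in> edges N. e \<subseteq> X \<and> x \<in> e}. w1 e)" for x
  define B where "B x = s1 ` {y \<in> X. {x, y} \<in> edges N}" for x
  have finB: "finite (B x)" if "x \<in> F" for x
    using fin by (simp add: B_def)
  have "card (B x) \<le> d" if "x \<in> F" for x
    unfolding B_def using nbrs[OF that] fin by (intro order_trans[OF card_image_le]) auto
  then have sumB: "(\<Sum>x\<in>F. card (B x)) \<le> card F * d"
    using sum_bounded_above[of F "\<lambda>x. card (B x)" d] by simp
  have LF: "finite (L {x, y}) \<and> 3 + (\<Sum>x\<in>F. card (B x)) \<le> card (L {x, y})"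
    if "x \<in> F" "y \<in> F" "x \<noteq> y" for x y
    using L[OF clique[OF that]] sumB by simp
  have "\<exists>w. (\<forall>x\<in>F. \<forall>y\<in>F. x \<noteq> y \<longrightarrow> w {x, y} \<in> L {x, y}) \<and>
    inj_on (\<lambda>x. g x + (\<Sum>y\<in>F - {x}. w {x, y})) F \<and>
    (\<forall>x\<in>F. g x + (\<Sum>y\<in>F - {x}. w {x, y}) \<notin> B x) \<and>
    (\<forall>x\<in>F. (\<Sum>y\<in>F - {x}. Min (L {x, y})) < (\<Sum>y\<in>F - {x}. w {x, y}))"
    using fin(1) cardF finB LF by (rule clique_weighting[where f = g and B = B and L = L])
  then obtain w2 where w2: "\<forall>x\<in>F. \<forall>y\<in>F. x \<noteq> y \<longrightarrow> w2 {x, y} \<in> L {x, y}"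
    and inj: "inj_on (\<lambda>x. g x + (\<Sum>y\<in>F - {x}. w2 {x, y})) F"
    and avoid: "\<forall>x\<in>F. g x + (\<Sum>y\<in>F - {x}. w2 {x, y}) \<notin> B x"
    by (elim exE conjE) (rule that)
  define w where "w e = (if e \<subseteq> X then w1 e else if e \<subseteq> F then w2 e else c e)" for e
  define s where "s x = f x + (\<Sum>e\<in>{e \<in> edges N. e \<subseteq> F \<union> X \<and> x \<in> e}. w e)" for x
  have sumR: "(\<Sum>e\<in>R x. w e) = (\<Sum>e\<in>R x. c e)" for x
    by (intro sum.cong) (auto simp: R_def w_def)
  have finR: "finite (R x)" for x
    using finE by (simp add: R_def)
  have s_X: "s x = s1 x" if x: "x \<in> X" for x
  proof -
    have "{e \<in> edges N. e \<subseteq> F \<union> X \<and> x \<in> e} = R x \<union> {e \<in> edges N. e \<subseteq> X \<and> x \<in> e}"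
      using x disj by (auto simp: R_def)
    moreover have "R x \<inter> {e \<in> edges N. e \<subseteq> X \<and> x \<in> e} = {}"
      by (auto simp: R_def)
    ultimately have "s x = f x + ((\<Sum>e\<in>R x. w e) + (\<Sum>e\<in>{e \<in> edges N. e \<subseteq> X \<and> x \<in> e}. w e))"
      using finE finR by (simp add: s_def sum.union_disjoint)
    also have "(\<Sum>e\<in>{e \<in> edges N. e \<subseteq> X \<and> x \<in> e}. w e) =
        (\<Sum>e\<in>{e \<in> edges N. e \<subseteq> X \<and> x \<in> e}. w1 e)"
      by (intro sum.cong) (auto simp: w_def)
    finally show ?thesis
      by (simp add: s1_def g_def sumR)
  qed
  have s_F: "s x = g x + (\<Sum>y\<in>F - {x}. w2 {x, y})" if x: "x \<in> F" for x
  proof -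
    \<comment> \<open>The clique weighting sums over the other vertices of \<open>F\<close>, the
      vertex sum over edges; this bijection links the two.\<close>
    have "{e \<in> edges N. e \<subseteq> F \<and> x \<in> e} = (\<lambda>y. {x, y}) ` (F - {x})" (is "?l = ?r")
    proof
      show "?l \<subseteq> ?r"
      proof
        fix e
        assume e: "e \<in> ?l"
        then obtain a b where "e = {a, b}" "a \<noteq> b"
          using edge_doubleton[OF N] by (metis (lifting) mem_Collect_eq)
        with e show "e \<in> ?r" by auto
      qed
      show "?r \<subseteq> ?l" using clique x by auto
    qed
    moreover have "inj_on (\<lambda>y. {x, y}) (F - {x})"
      by (auto simp: inj_on_def doubleton_eq_iff)
    moreover have "w {x, y} = w2 {x, y}" if "y \<in> F - {x}" for y
      using that x disj by (auto simp: w_def)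
    ultimately have sumF: "(\<Sum>e\<in>{e \<in> edges N. e \<subseteq> F \<and> x \<in> e}. w e) = (\<Sum>y\<in>F - {x}. w2 {x, y})"
      by (simp add: sum.reindex)
    have "{e \<in> edges N. e \<subseteq> F \<union> X \<and> x \<in> e} = R x \<union> {e \<in> edges N. e \<subseteq> F \<and> x \<in> e}"
      using x disj by (auto simp: R_def)
    moreover have "R x \<inter> {e \<in> edges N. e \<subseteq> F \<and> x \<in> e} = {}"
      by (auto simp: R_def)
    ultimately have "s x = f x + ((\<Sum>e\<in>R x. w e) + (\<Sum>e\<in>{e \<in> edges N. e \<subseteq> F \<and> x \<in> e}. w e))"
      using finE finR by (simp add: s_def sum.union_disjoint)
    then show ?thesis
      by (simp add: sumF sumR g_def)
  qed
  have mem: "w e \<in> L e" if e: "e \<in> edges N" "e \<subseteq> F \<union> X" for e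
  proof -
    consider "e \<subseteq> X" | "\<not> e \<subseteq> X" "e \<subseteq> F" | "\<not> e \<subseteq> X" "\<not> e \<subseteq> F" by blast
    then show ?thesis
    proof cases
      case 2
      obtain a b where "e = {a, b}" "a \<noteq> b"
        using edge_doubleton[OF N e(1)] by metis
      then show ?thesis using 2 w2 by (auto simp: w_def)
    qed (use w1 c e in \<open>auto simp: w_def\<close>)
  qed
  have cross: "s x \<noteq> s y" if "x \<in> F" "y \<in> X" "{x, y} \<in> edges N" for x y
    using bspec[OF avoid that(1)] that by (auto simp: s_F s_X B_def)
  have "s x \<noteq> s y" if xy: "x \<in> F \<union> X" "y \<in> F \<union> X" "{x, y} \<in> edges N" for x y
  proof -
    have "x \<noteq> y"
      using edge_doubleton[OF N xy(3)] by (metis doubleton_eq_iff)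
    consider "x \<in> F" "y \<in> F" | "x \<in> F" "y \<in> X" | "x \<in> X" "y \<in> F" | "x \<in> X" "y \<in> X"
      using xy by blast
    then show ?thesis
    proof cases
      case 1
      then show ?thesis
        using inj \<open>x \<noteq> y\<close> by (auto simp: s_F inj_on_def)
    next
      case 2
      then show ?thesis using cross xy by blast
    next
      case 3
      then show ?thesis using cross[of y x] xy by (auto simp: insert_commute)
    next
      case 4
      then show ?thesis
        using col1 xy unfolding proper_colouring_def incident_edges_induced_ugraph
        by (auto simp: s_X s1_def induced_ugraph_def)
    qed
  qed
  then show "\<exists>w. (\<forall>e\<in>edges (induced_ugraph N (F \<union> X)). w e \<in> L e) \<and>
    proper_colouring (induced_ugraph N (F \<union> X))
      (\<lambda>v. f v + (\<Sum>e\<in>incident_edges (induced_ugraph N (F \<union> X)) v. w e))"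
    using mem unfolding proper_colouring_def incident_edges_induced_ugraph s_def
    by (intro exI[of _ w]) (auto simp: induced_ugraph_def)
qed

section \<open>Products with a complete graph\<close>

text \<open>An unordered pair may be witnessed in either order; the adjacency condition is
  symmetric, so both give the same criterion.\<close>

lemma box_product_edge_iff:
  assumes "u \<in> verts G" "v \<in> verts G" "u' \<in> verts H" "v' \<in> verts H"
  shows "{(u, u'), (v, v')} \<in> edges (box_product G H) \<longleftrightarrow>
    u = v \<and> {u', v'} \<in> edges H \<or> u' = v' \<and> {u, v} \<in> edges G"
  using assms unfolding box_product_def by (force simp: doubleton_eq_iff insert_commute)

lemma simple_graph_doubleton_neq:
  assumes "simple_graph N" "{x, y} \<in> edges N"
  shows "x \<noteq> y"
  using edge_doubleton[OF assms] by (metis doubleton_eq_iff)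

lemma simple_graph_box_product:
  assumes "simple_graph G" "simple_graph H"
  shows "simple_graph (box_product G H)"
proof -
  have "edges (box_product G H) \<subseteq> [verts G \<times> verts H]\<^bsup>2\<^esup>"
    using simple_graph_doubleton_neq[OF assms(1)] simple_graph_doubleton_neq[OF assms(2)]
    by (fastforce simp: box_product_def nsets_def card_insert_if)
  then show ?thesis
    using assms by (simp add: simple_graph_def box_product_def)
qed

lemma simple_graph_complete_graph: "simple_graph (complete_graph n)"
  by (simp add: simple_graph_def complete_graph_def)

text \<open>Degeneracy counts edges at \<open>v\<close> while adding a clique requires counting
  neighbours; mapping \<open>u\<close> to \<open>{v, u}\<close> is injective.\<close>

lemma card_neighbours_le_vert_degree:
  assumes "simple_graph G" "v \<in> U" "X \<subseteq> U"
  shows "card {u \<in> X. {v, u} \<in> edges G} \<le> vert_degree (induced_ugraph G U) v"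
  unfolding vert_degree_def incident_edges_induced_ugraph
proof (rule card_inj_on_le)
  show "inj_on (\<lambda>u. {v, u}) {u \<in> X. {v, u} \<in> edges G}"
    by (auto simp: inj_on_def doubleton_eq_iff)
  show "finite {e \<in> edges G. e \<subseteq> U \<and> v \<in> e}"
    using finite_edges[OF assms(1)] by simp
qed (use assms in auto)

text \<open>Induction on \<open>U\<close>, removing a vertex \<open>v\<close> of degree at most
  \<open>d\<close>. Its fibre is a clique on \<open>n\<close> vertices, and the neighbours of
  \<open>(v, i)\<close> in the other fibres are the \<open>(u, i)\<close> with \<open>u\<close>
  adjacent to \<open>v\<close>.\<close>

lemma list_weightable_box_complete:
  fixes G :: "'a ugraph" and L :: "('a \<times> nat) set \<Rightarrow> real set"
  defines "N n \<equiv> box_product G (complete_graph n)"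
  assumes n: "3 \<le> n" and G: "simple_graph G" and deg: "degenerate d G"
    and L: "\<And>e. e \<in> edges (N n) \<Longrightarrow> finite (L e) \<and> n * d + 3 \<le> card (L e)"
    and U: "U \<subseteq> verts G"
  shows "list_weightable L (induced_ugraph (N n) (U \<times> {..<n}))"
proof -
  have finU: "finite U"
    using G U by (auto simp: simple_graph_def intro: finite_subset)
  have N: "simple_graph (N n)"
    unfolding N_def by (intro simple_graph_box_product G simple_graph_complete_graph)
  have vN: "verts (N n) = verts G \<times> {..<n}"
    by (simp add: N_def box_product_def complete_graph_def)
  have eN: "{(u, i), (v, j)} \<in> edges (N n) \<longleftrightarrow> u = v \<and> i \<noteq> j \<or> i = j \<and> {u, v} \<in> edges G"
    if "u \<in> verts G" "v \<in> verts G" "i < n" "j < n" for u v i j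
    using that unfolding N_def
    by (subst box_product_edge_iff) (auto simp: complete_graph_def nsets_def card_insert_if)
  show ?thesis
    using finU U
  proof (induction U rule: finite_psubset_induct)
    case (psubset U)
    show ?case
    proof (cases "U = {}")
      case True
      \<comment> \<open>Only the empty set could be an edge inside the empty vertex set.\<close>
      have "{} \<notin> edges (N n)"
        using edge_doubleton[OF N] by blast
      with True show ?thesis
        by (auto simp: list_weightable_def proper_colouring_def induced_ugraph_def)
    next
      case False
      then obtain v where v: "v \<in> U" "vert_degree (induced_ugraph G U) v \<le> d"
        using deg psubset.prems unfolding degenerate_def by blast
      define U' where "U' = U - {v}"
      have vV: "v \<in> verts G" and U'V: "\<And>u. u \<in> U' \<Longrightarrow> u \<in> verts G \<and> u \<noteq> v"
        using v psubset.prems by (auto simp: U'_def)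
      have "list_weightable L (induced_ugraph (N n) ({v} \<times> {..<n} \<union> U' \<times> {..<n}))"
      proof (rule list_weightable_add_clique[OF N])
        show "{v} \<times> {..<n} \<inter> U' \<times> {..<n} = {}"
          by (auto simp: U'_def)
        show "{v} \<times> {..<n} \<union> U' \<times> {..<n} \<subseteq> verts (N n)"
          using v psubset.prems by (auto simp: U'_def vN)
        show "3 \<le> card ({v} \<times> {..<n})"
          using n by (simp add: card_cartesian_product)
        show "{x, y} \<in> edges (N n)" if "x \<in> {v} \<times> {..<n}" "y \<in> {v} \<times> {..<n}" "x \<noteq> y" for x y
          using that v psubset.prems by (auto simp: eN)
        show "finite (L e) \<and> card ({v} \<times> {..<n}) * d + 3 \<le> card (L e)" if "e \<in> edges (N n)" for e
          using L[OF that] by (simp add: card_cartesian_product)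
        show "list_weightable L (induced_ugraph (N n) (U' \<times> {..<n}))"
          using v psubset.prems by (intro psubset.IH) (auto simp: U'_def)
        fix x
        assume "x \<in> {v} \<times> {..<n}"
        then obtain i where x: "x = (v, i)" "i < n"
          by auto
        have "{y \<in> U' \<times> {..<n}. {x, y} \<in> edges (N n)} = (\<lambda>u. (u, i)) ` {u \<in> U'. {v, u} \<in> edges G}"
          using x(2) vV U'V by (force simp: x(1) eN)
        then have "card {y \<in> U' \<times> {..<n}. {x, y} \<in> edges (N n)} = card {u \<in> U'. {v, u} \<in> edges G}"
          by (simp add: card_image inj_on_def)
        also have "\<dots> \<le> d"
          using card_neighbours_le_vert_degree[OF G v(1), of U'] v(2) by (auto simp: U'_def)
        finally show "card {y \<in> U' \<times> {..<n}. {x, y} \<in> edges (N n)} \<le> d" .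
      qed
      moreover have "{v} \<times> {..<n} \<union> U' \<times> {..<n} = U \<times> {..<n}"
        using v by (auto simp: U'_def)
      ultimately show ?thesis
        by simp
    qed
  qed
qed

theorem corollary5p3:
  fixes G :: "'a ugraph" and n d :: nat
  assumes "n \<ge> 3"
    and "simple_graph G"
    and "degenerate d G"
  shows "ch_sum_edge (box_product G (complete_graph n)) \<le> enat (n * d + 3)"
proof -
  let ?N = "box_product G (complete_graph n)"
  have N: "simple_graph ?N"
    by (intro simple_graph_box_product assms simple_graph_complete_graph)
  have "verts ?N = verts G \<times> {..<n}"
    by (simp add: box_product_def complete_graph_def)
  moreover have "induced_ugraph ?N (verts ?N) = ?N"
  proof -
    have "{e \<in> edges ?N. e \<subseteq> verts ?N} = edges ?N"
      using N by (auto simp: simple_graph_def nsets_def)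
    then show ?thesis
      by (simp add: induced_ugraph_def)
  qed
  ultimately have induced: "induced_ugraph ?N (verts G \<times> {..<n}) = ?N"
    by simp
  have "sum_edge_choosable (n * d + 3) ?N"
    unfolding sum_edge_choosable_def
  proof (intro allI impI)
    fix L :: "('a \<times> nat) set \<Rightarrow> real set"
    assume "\<forall>e\<in>edges ?N. finite (L e) \<and> card (L e) = n * d + 3"
    then have "list_weightable L ?N"
      using list_weightable_box_complete[OF assms, of L "verts G"] by (simp add: induced)
    then show "\<exists>w. (\<forall>e\<in>edges ?N. w e \<in> L e) \<and>
      proper_colouring ?N (\<lambda>v. \<Sum>e\<in>incident_edges ?N v. w e)"
      \<comment> \<open>Zero offsets give the plain vertex sums.\<close>
      unfolding list_weightable_def by (elim allE[of _ "\<lambda>_. 0"]) simp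
  qed
  then show ?thesis
    unfolding ch_sum_edge_def by (intro Inf_lower) auto
qed

end
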